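(* For any belief $b\in\mathcal{B}$ and any horizon $T\in\mathbb{Z}_{+}$, the linear relaxation of the MILP (without the inequalities (V)) is equivalent to the MDP approximation with finite horizon $T$: for every feasible solution of one of these two problems there is a feasible solution of the other with the same objective value (in particular $z_{\mathrm{R}}^T(b)$ equals the optimal value of the MDP approximation). Moreover, $$w_{\mathrm{ml}}^{T}(b)\le w^{T}(b)\le z_{\mathrm{R}^{\mathrm{c}}}^{T}(b)\le z_{\mathrm{R}}^{T}(b).$$
   Context: **POMDP.** $\mathcal{S},\mathcal{O},\mathcal{A}$ are finite nonempty sets (states, observations, actions); $p(o|s)$ is a probability distribution on $\mathcal{O}$ for each $s$; $p(s'|s,a)$ is a probability distribution on $\mathcal{S}$ for each $(s,a)$; $r_t:\mathcal{S}\times\mathcal{A}\to\mathbb{R}$, $t\in\{0,\dots,T\}$, are arbitrary reward functions; $\mathcal{B}$ is the set of probability distributions on $\mathcal{S}$ and $b\in\mathcal{B}$ is the initial belief. Write $[T]=\{0,\dots,T\}$. **Policies and values.** A history-dependent policy $\delta\in\Delta^T$ specifies, for each $t\in[T]$ and history $h_t=(o_0,a_0,o_1,\dots,a_{t-1},o_t)$, a probability distribution $\delta^t(\cdot|h_t)$ on $\mathcal{A}$. $\Delta_{\mathrm{ml}}^T$ is the set of memoryless policies, i.e. families $\delta=(\delta^t_{a|o})_{t\in[T],a,o}$ with $\delta^t_{a|o}\ge0$, $\sum_a\delta^t_{a|o}=1$ (the action at $t$ depends only on $o_t$). $\Delta_{\mathrm{ml}}^{T,\mathrm{d}}$ is the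 subset with all entries in $\{0,1\}$. Under a policy, $S_0\sim b$, $O_t\sim p(\cdot|S_t)$, $A_t$ is drawn from the policy, and $S_{t+1}\sim p(\cdot|S_t,A_t)$. $\mathbb{E}_\delta[\cdot|S_0\sim b,A_0=a]$ denotes expectation when the initial action is forced to be $a$ regardless of $O_0$, the subsequent actions being drawn from $\delta$. Define $$w_{\mathrm{ml}}^T(b)=\max_{a\in\mathcal{A},\delta\in\Delta_{\mathrm{ml}}^T}\mathbb{E}_\delta\Big[\sum_{t=0}^Tr_t(S_t,A_t)\Big|S_0\sim b,A_0=a\Big],\qquad w^T(b)=\max_{a\in\mathcal{A},\delta\in\Delta^T}\mathbb{E}_\delta\Big[\sum_{t=0}^Tr_t(S_t,A_t)\Big|S_0\sim b,A_0=a\Big].$$ **MDP approximation with finite horizon $T$.** The problem of maximizing $\mathbb{E}[\sum_{t=0}^Tr_t(S_t,A_t)|S_0\sim b]$ when the decision maker observes the state, i.e. over policies $\delta^t(a|s)$; its feasible solutions are these policies and its objective is the expected total reward. **MILP.** Variables $\mu=\big((\mu_s^t)_{t\in[T+1]},(\mu_{soa}^t)_{t\in[T]},(\mu_{sa}^t)_{t\in[T]}\big)$ and $\delta$. Maximize $\sum_{t=0}^T\sum_{s,a}r_t(s,a)\mu_{sa}^t$ subject to: - $\delta^0_{a|o}=\delta^0_{a|o'}$ for all $o,o',a$; - $\mu_s^0=b(s)$ for all $s$; - $\mu_s^t=\sum_a\mu_{sa}^t$ for all $s$, $t\in[T]$; - $\mu_{sa}^t=\sum_o\mu_{soa}^t$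 for all $s,a$, $t\in[T]$; - $\mu_s^{t+1}=\sum_{s',a'}p(s|s',a')\mu_{s'a'}^t$ for all $s$, $t\in[T]$; - (McCormick) $\mu_{soa}^t\le p(o|s)\mu_s^t$, $\ \mu_{soa}^t\le\delta^t_{a|o}$, $\ \mu_{soa}^t\ge p(o|s)\mu_s^t+\delta^t_{a|o}-1$ for all $s,o,a$, $t\in[T]$; - $\delta\in\Delta_{\mathrm{ml}}^{T,\mathrm{d}}$, $\mu\ge0$. Its linear relaxation replaces $\delta\in\Delta_{\mathrm{ml}}^{T,\mathrm{d}}$ by $\delta\in\Delta_{\mathrm{ml}}^{T}$; $z_{\mathrm{R}}^T(b)$ is the optimal value of the linear relaxation. **Inequalities (V).** With additional nonnegative variables $\mu_{s'a'soa}^t$ ($t\in\{1,\dots,T\}$), for all $t\in\{1,\dots,T\}$: - $\sum_{s',a'}\mu_{s'a'soa}^t=\mu_{soa}^t$ for all $s,o,a$; - $\sum_{a}\mu_{s'a'soa}^t=p(o|s)p(s|s',a')\mu_{s'a'}^{t-1}$ for all $s',a',s,o$; - $\mu_{s'a'soa}^t=p(s|s',a',o)\sum_{\bar s}\mu_{s'a'\bar soa}^t$ for all $s',a',s,o,a$, where $p(s|s',a',o)=\dfrac{p(o|s)p(s|s',a')}{\sum_{\bar s}p(o|\bar s)p(\bar s|s',a')}$ (set to $0$ when the denominator vanishes). $z_{\mathrm{R}^{\mathrm{c}}}^T(b)$ is the optimal value of the linear relaxation with the variables $\mu^t_{s'a'soa}$ and the constraints (V) added. *)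

theory Defs
  imports "HOL-Probability.Probability"
begin

text \<open>
  States, observations and actions are types of class \<open>finite\<close>. A distribution on a finite type
  is a \<open>pmf\<close>, that is, a nonnegative family with sum 1; this covers the kernels, the beliefs and
  the policies alike. Horizons are natural numbers and all time-indexed families are total
  functions on \<open>nat\<close>, of which only the entries up to the horizon are ever used.
\<close>

record ('s, 'o, 'a) pomdp =
  obs :: "'s \<Rightarrow> 'o pmf"
  step :: "'s \<Rightarrow> 'a \<Rightarrow> 's pmf"
  reward :: "nat \<Rightarrow> 's \<Rightarrow> 'a \<Rightarrow> real"

text \<open>
  For a history-dependent policy, \<open>\<delta> t h ob\<close> is the action distribution at time \<open>t\<close> when
  \<open>h = [(o\<^sub>0, a\<^sub>0), \<dots>, (o\<^sub>t\<^sub>-\<^sub>1, a\<^sub>t\<^sub>-\<^sub>1)]\<close> and the current observation is \<open>ob\<close>.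
\<close>

type_synonym ('o, 'a) hist_policy = "nat \<Rightarrow> ('o \<times> 'a) list \<Rightarrow> 'o \<Rightarrow> 'a pmf"
type_synonym ('o, 'a) ml_policy = "nat \<Rightarrow> 'o \<Rightarrow> 'a pmf"
type_synonym ('s, 'a) mdp_policy = "nat \<Rightarrow> 's \<Rightarrow> 'a pmf"

definition hist_of_ml :: "('o, 'a) ml_policy \<Rightarrow> ('o, 'a) hist_policy" where
  "hist_of_ml \<delta> = (\<lambda>t h ob. \<delta> t ob)"

definition deterministic :: "nat \<Rightarrow> ('o, 'a) ml_policy \<Rightarrow> bool" where
  "deterministic T \<delta> \<longleftrightarrow> (\<forall>t\<le>T. \<forall>ob a. pmf (\<delta> t ob) a \<in> {0, 1})"

text \<open>
  The law of \<open>[(S\<^sub>0, O\<^sub>0, A\<^sub>0), \<dots>, (S\<^sub>T, O\<^sub>T, A\<^sub>T)]\<close>.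
\<close>

primrec trajectory ::
  "('s, 'o, 'a) pomdp \<Rightarrow> 's pmf \<Rightarrow> ('o, 'a) hist_policy \<Rightarrow> nat \<Rightarrow> ('s \<times> 'o \<times> 'a) list pmf"
where
  "trajectory M b \<delta> 0 =
     do {
       s \<leftarrow> b;
       ob \<leftarrow> obs M s;
       a \<leftarrow> \<delta> 0 [] ob;
       return_pmf [(s, ob, a)]
     }"
| "trajectory M b \<delta> (Suc t) =
     do {
       \<omega> \<leftarrow> trajectory M b \<delta> t;
       s \<leftarrow> (case last \<omega> of (s', ob', a') \<Rightarrow> step M s' a');
       ob \<leftarrow> obs M s;
       a \<leftarrow> \<delta> (Suc t) (map snd \<omega>) ob;
       return_pmf (\<omega> @ [(s, ob, a)])
     }"

definition total_reward :: "('s, 'o, 'a) pomdp \<Rightarrow> nat \<Rightarrow> ('s \<times> 'o \<times> 'a) list \<Rightarrow> real" where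
  "total_reward M T \<omega> = (\<Sum>t=0..T. case \<omega> ! t of (s, ob, a) \<Rightarrow> reward M t s a)"

definition force_initial :: "'a \<Rightarrow> ('o, 'a) hist_policy \<Rightarrow> ('o, 'a) hist_policy" where
  "force_initial a \<delta> = \<delta>(0 := (\<lambda>h ob. return_pmf a))"

text \<open>Here the initial action is \<open>a\<close> whatever \<open>O\<^sub>0\<close> is, and it enters the later histories as such.\<close>

definition expected_reward ::
  "('s, 'o, 'a) pomdp \<Rightarrow> nat \<Rightarrow> 's pmf \<Rightarrow> 'a \<Rightarrow> ('o, 'a) hist_policy \<Rightarrow> real"
where
  "expected_reward M T b a \<delta> =
     measure_pmf.expectation (trajectory M b (force_initial a \<delta>) T) (total_reward M T)"

text \<open>
  Maxima and optimal values are written with \<^const>\<open>Greatest\<close>: the greatest element of the set of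
  attained values. It exists in every case below, since the feasible sets are nonempty and compact
  (up to irrelevant entries beyond the horizon) and the objectives are continuous.
\<close>

definition w_ml :: "('s::finite, 'o::finite, 'a::finite) pomdp \<Rightarrow> nat \<Rightarrow> 's pmf \<Rightarrow> real" where
  "w_ml M T b =
     (GREATEST v. \<exists>a (\<delta> :: ('o, 'a) ml_policy). v = expected_reward M T b a (hist_of_ml \<delta>))"

definition w_hist :: "('s::finite, 'o::finite, 'a::finite) pomdp \<Rightarrow> nat \<Rightarrow> 's pmf \<Rightarrow> real" where
  "w_hist M T b =
     (GREATEST v. \<exists>a (\<delta> :: ('o, 'a) hist_policy). v = expected_reward M T b a \<delta>)"


subsection \<open>The MDP approximation\<close>

primrec mdp_trajectory ::
  "('s, 'o, 'a) pomdp \<Rightarrow> 's pmf \<Rightarrow> ('s, 'a) mdp_policy \<Rightarrow> nat \<Rightarrow> ('s \<times> 'a) list pmf"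
where
  "mdp_trajectory M b \<pi> 0 =
     do {
       s \<leftarrow> b;
       a \<leftarrow> \<pi> 0 s;
       return_pmf [(s, a)]
     }"
| "mdp_trajectory M b \<pi> (Suc t) =
     do {
       \<omega> \<leftarrow> mdp_trajectory M b \<pi> t;
       s \<leftarrow> (case last \<omega> of (s', a') \<Rightarrow> step M s' a');
       a \<leftarrow> \<pi> (Suc t) s;
       return_pmf (\<omega> @ [(s, a)])
     }"

definition mdp_objective ::
  "('s, 'o, 'a) pomdp \<Rightarrow> nat \<Rightarrow> 's pmf \<Rightarrow> ('s, 'a) mdp_policy \<Rightarrow> real"
where
  "mdp_objective M T b \<pi> =
     measure_pmf.expectation (mdp_trajectory M b \<pi> T)
       (\<lambda>\<omega>. \<Sum>t=0..T. case \<omega> ! t of (s, a) \<Rightarrow> reward M t s a)"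

definition z_mdp :: "('s::finite, 'o::finite, 'a::finite) pomdp \<Rightarrow> nat \<Rightarrow> 's pmf \<Rightarrow> real" where
  "z_mdp M T b = (GREATEST v. \<exists>\<pi>. v = mdp_objective M T b \<pi>)"


subsection \<open>The MILP and its linear relaxations\<close>

record ('s, 'o, 'a) milp_vars =
  mu_s :: "nat \<Rightarrow> 's \<Rightarrow> real"
  mu_soa :: "nat \<Rightarrow> 's \<Rightarrow> 'o \<Rightarrow> 'a \<Rightarrow> real"
  mu_sa :: "nat \<Rightarrow> 's \<Rightarrow> 'a \<Rightarrow> real"

definition milp_objective ::
  "('s::finite, 'o::finite, 'a::finite) pomdp \<Rightarrow> nat \<Rightarrow> ('s, 'o, 'a) milp_vars \<Rightarrow> real"
where
  "milp_objective M T \<mu> = (\<Sum>t=0..T. \<Sum>s\<in>UNIV. \<Sum>a\<in>UNIV. reward M t s a * mu_sa \<mu> t s a)"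

definition mccormick ::
  "('s, 'o, 'a) pomdp \<Rightarrow> nat \<Rightarrow> ('s, 'o, 'a) milp_vars \<Rightarrow> ('o, 'a) ml_policy \<Rightarrow> bool"
where
  "mccormick M T \<mu> \<delta> \<longleftrightarrow>
     (\<forall>t\<le>T. \<forall>s ob a.
        mu_soa \<mu> t s ob a \<le> pmf (obs M s) ob * mu_s \<mu> t s \<and>
        mu_soa \<mu> t s ob a \<le> pmf (\<delta> t ob) a \<and>
        mu_soa \<mu> t s ob a \<ge> pmf (obs M s) ob * mu_s \<mu> t s + pmf (\<delta> t ob) a - 1)"

text \<open>
  In the linear relaxation, \<open>\<delta>\<close> ranges over all memoryless policies; the constraints
  \<open>pmf (\<delta> t ob) a \<ge> 0\<close> and \<open>(\<Sum>a. pmf (\<delta> t ob) a) = 1\<close> are part of the type.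
\<close>

definition relax_feasible ::
  "('s::finite, 'o::finite, 'a::finite) pomdp \<Rightarrow> nat \<Rightarrow> 's pmf
    \<Rightarrow> ('s, 'o, 'a) milp_vars \<Rightarrow> ('o, 'a) ml_policy \<Rightarrow> bool"
where
  "relax_feasible M T b \<mu> \<delta> \<longleftrightarrow>
     (\<forall>ob ob' a. pmf (\<delta> 0 ob) a = pmf (\<delta> 0 ob') a) \<and>
     (\<forall>s. mu_s \<mu> 0 s = pmf b s) \<and>
     (\<forall>t\<le>T. \<forall>s. mu_s \<mu> t s = (\<Sum>a\<in>UNIV. mu_sa \<mu> t s a)) \<and>
     (\<forall>t\<le>T. \<forall>s a. mu_sa \<mu> t s a = (\<Sum>ob\<in>UNIV. mu_soa \<mu> t s ob a)) \<and>
     (\<forall>t\<le>T. \<forall>s. mu_s \<mu> (Suc t) s =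
        (\<Sum>s'\<in>UNIV. \<Sum>a'\<in>UNIV. pmf (step M s' a') s * mu_sa \<mu> t s' a')) \<and>
     mccormick M T \<mu> \<delta> \<and>
     (\<forall>t\<le>Suc T. \<forall>s. mu_s \<mu> t s \<ge> 0) \<and>
     (\<forall>t\<le>T. \<forall>s ob a. mu_soa \<mu> t s ob a \<ge> 0) \<and>
     (\<forall>t\<le>T. \<forall>s a. mu_sa \<mu> t s a \<ge> 0)"

definition milp_feasible ::
  "('s::finite, 'o::finite, 'a::finite) pomdp \<Rightarrow> nat \<Rightarrow> 's pmf
    \<Rightarrow> ('s, 'o, 'a) milp_vars \<Rightarrow> ('o, 'a) ml_policy \<Rightarrow> bool"
where
  "milp_feasible M T b \<mu> \<delta> \<longleftrightarrow> relax_feasible M T b \<mu> \<delta> \<and> deterministic T \<delta>"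

definition z_R :: "('s::finite, 'o::finite, 'a::finite) pomdp \<Rightarrow> nat \<Rightarrow> 's pmf \<Rightarrow> real" where
  "z_R M T b = (GREATEST v. \<exists>\<mu> \<delta>. relax_feasible M T b \<mu> \<delta> \<and> v = milp_objective M T \<mu>)"

text \<open>
  The probability of \<open>s\<close> given the previous state \<open>s'\<close>, the previous action \<open>a'\<close> and the current
  observation \<open>ob\<close>; it is \<open>0\<close> when the denominator vanishes, because \<open>x / 0 = 0\<close>.
\<close>

definition state_posterior ::
  "('s::finite, 'o, 'a) pomdp \<Rightarrow> 's \<Rightarrow> 's \<Rightarrow> 'a \<Rightarrow> 'o \<Rightarrow> real"
where
  "state_posterior M s s' a' ob =
     pmf (obs M s) ob * pmf (step M s' a') s /
     (\<Sum>s''\<in>UNIV. pmf (obs M s'') ob * pmf (step M s' a') s'')"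

text \<open>In \<open>\<nu> t s' a' s ob a\<close>, the pair \<open>(s', a')\<close> belongs to time \<open>t - 1\<close>.\<close>

definition valid_ineqs ::
  "('s::finite, 'o::finite, 'a::finite) pomdp \<Rightarrow> nat \<Rightarrow> ('s, 'o, 'a) milp_vars
    \<Rightarrow> (nat \<Rightarrow> 's \<Rightarrow> 'a \<Rightarrow> 's \<Rightarrow> 'o \<Rightarrow> 'a \<Rightarrow> real) \<Rightarrow> bool"
where
  "valid_ineqs M T \<mu> \<nu> \<longleftrightarrow>
     (\<forall>t\<in>{1..T}.
        (\<forall>s' a' s ob a. \<nu> t s' a' s ob a \<ge> 0) \<and>
        (\<forall>s ob a. (\<Sum>s'\<in>UNIV. \<Sum>a'\<in>UNIV. \<nu> t s' a' s ob a) = mu_soa \<mu> t s ob a) \<and>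
        (\<forall>s' a' s ob. (\<Sum>a\<in>UNIV. \<nu> t s' a' s ob a) =
           pmf (obs M s) ob * pmf (step M s' a') s * mu_sa \<mu> (t - 1) s' a') \<and>
        (\<forall>s' a' s ob a. \<nu> t s' a' s ob a =
           state_posterior M s s' a' ob * (\<Sum>s''\<in>UNIV. \<nu> t s' a' s'' ob a)))"

definition z_Rc :: "('s::finite, 'o::finite, 'a::finite) pomdp \<Rightarrow> nat \<Rightarrow> 's pmf \<Rightarrow> real" where
  "z_Rc M T b =
     (GREATEST v. \<exists>\<mu> \<delta> \<nu>. relax_feasible M T b \<mu> \<delta> \<and> valid_ineqs M T \<mu> \<nu> \<and>
        v = milp_objective M T \<mu>)"

end

theory Submission
  imports Defs
begin

text \<open>
  Feasibility in the linear relaxation is governed by the flow of state-action mass. The McCormick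
  constraints bind the variables \<open>\<mu>\<^sub>s\<^sub>o\<^sub>a\<close> to a product \<open>\<delta>\<^sub>a\<^sub>|\<^sub>o p(o|s) \<mu>\<^sub>s\<close> only loosely: for any
  process that follows the observation kernel and the transitions of the model, the law of the
  action alone, used as a policy for every observation, satisfies them
  (\<open>relax_feasible_law_vars\<close>). So an MDP policy yields a feasible solution, once an observation is
  drawn along with each state (\<open>relax_feasible_of_mdp_policy\<close>). Conversely, conditioning a
  feasible \<open>\<mu>\<^sub>s\<^sub>a\<close> on the state gives an MDP policy whose state-action laws are \<open>\<mu>\<close> again
  (\<open>mdp_policy_of_relax_feasible\<close>). The objective sees these laws only, so the two problems attain
  the same values.

  A history-dependent policy is another such process, and its reward is the objective of the
  solution made of its laws. This solution also satisfies (V), because \<open>S\<^sub>t\<close> is independent of the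
  history, and hence of \<open>A\<^sub>t\<close>, given \<open>S\<^sub>t\<^sub>-\<^sub>1\<close>, \<open>A\<^sub>t\<^sub>-\<^sub>1\<close> and \<open>O\<^sub>t\<close> (\<open>Rc_feasible_of_policy\<close>). Forcing the
  initial action is itself a choice of policy. The chain of inequalities thus comes from inclusions
  between sets of attained values: those of memoryless policies, of all policies, of the relaxation
  with (V), and of the relaxation without them.

  An inclusion yields an inequality of optimal values once the maxima exist
  (\<open>Greatest_mono_compact\<close>). Policies form a product of simplices; feasible solutions that are 0
  beyond the horizon form a closed subset of such a product and a cube. Both are compact, and the
  objectives are continuous (\<open>compact_policy_values\<close>, \<open>compact_relaxation_values\<close>).
\<close>

section \<open>Greatest elements of compact sets of values\<close>

lemma Greatest_compact:
  fixes P :: "real \<Rightarrow> bool"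
  assumes "compact {v. P v}" "\<exists>v. P v"
  shows "P (Greatest P)" "P v \<Longrightarrow> v \<le> Greatest P"
proof -
  obtain m where m: "P m" "\<And>v. P v \<Longrightarrow> v \<le> m"
    using compact_attains_sup[OF assms(1)] assms(2) by auto
  then have eq: "Greatest P = m"
    by (intro Greatest_equality)
  show "P (Greatest P)" "P v \<Longrightarrow> v \<le> Greatest P"
    unfolding eq by (use m in auto)
qed

text \<open>
  Optimal values are compared by inclusion of the sets of attained values; compactness
  is what makes \<^const>\<open>Greatest\<close> an actual maximum of such a set.
\<close>

lemma Greatest_mono_compact:
  fixes P Q :: "real \<Rightarrow> bool"
  assumes "compact {v. P v}" "\<exists>v. P v" "compact {v. Q v}" "\<And>v. P v \<Longrightarrow> Q v"
  shows "Greatest P \<le> Greatest Q"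
  using Greatest_compact[OF assms(1,2)] Greatest_compact(2)[OF assms(3)] assms(2,4) by blast

text \<open>
  Tychonoff's theorem in pointwise form. Index sets here are infinite, because policies and LP
  variables are total in time and a policy also reads histories of every length.
\<close>

lemma compact_functions:
  fixes A :: "'i \<Rightarrow> 'b::topological_space set"
  assumes "\<And>i. compact (A i)"
  shows "compact {f. \<forall>i. f i \<in> A i}"
proof -
  have "compactin (product_topology (\<lambda>i. euclidean) UNIV) (PiE UNIV A)"
    using assms by (simp add: compactin_PiE)
  moreover have "PiE UNIV A = {f. \<forall>i. f i \<in> A i}"
    by auto
  ultimately show ?thesis
    by (simp add: euclidean_product_topology)
qed

lemma ex_pmf_of_weights:
  fixes q :: "'a::finite \<Rightarrow> real"
  assumes "\<And>x. 0 \<le> q x" "(\<Sum>x\<in>UNIV. q x) = 1"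
  shows "\<exists>p. pmf p = q"
proof
  have "pmf (embed_pmf q) x = q x" for x
    by (rule pmf_embed_pmf)
      (use assms in \<open>simp_all add: nn_integral_count_space_finite\<close>)
  then show "pmf (embed_pmf q) = q" by auto
qed

lemma sum_pmf_UNIV: "(\<Sum>x\<in>UNIV. pmf p x) = 1" for p :: "'a::finite pmf"
  by (rule sum_pmf_eq_1) auto

text \<open>
  The type of distributions carries no topology, so limits are taken in this simplex of weight
  functions, from which \<open>inv pmf\<close> leads back to distributions.
\<close>

lemma range_pmf_simplex:
  "range (pmf :: 'a::finite pmf \<Rightarrow> _) = {q. (\<forall>x. q x \<in> {0..1}) \<and> (\<Sum>x\<in>UNIV. q x) = 1}"
proof (intro equalityI subsetI)
  fix q :: "'a \<Rightarrow> real"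
  assume "q \<in> {q. (\<forall>x. q x \<in> {0..1}) \<and> (\<Sum>x\<in>UNIV. q x) = 1}"
  then have "\<exists>p. pmf p = q" by (intro ex_pmf_of_weights) auto
  then show "q \<in> range pmf" by blast
qed (auto simp: sum_pmf_UNIV pmf_le_1)

text \<open>
  Feasible regions are cut out of a compact set by conjunctions of weak inequalities between
  continuous functions. The rules below follow the syntax of such a predicate, so that a constraint
  system unfolds into continuity goals.
\<close>

lemma closedin_le_on:
  fixes f g :: "'x::topological_space \<Rightarrow> real"
  assumes "continuous_on K f" "continuous_on K g"
  shows "closedin (top_of_set K) {x \<in> K. f x \<le> g x}"
proof -
  have "closedin (top_of_set K) (K \<inter> (\<lambda>x. g x - f x) -` {0..})"
    by (intro continuous_closedin_preimage continuous_intros assms closed_atLeast)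
  also have "K \<inter> (\<lambda>x. g x - f x) -` {0..} = {x \<in> K. f x \<le> g x}" by auto
  finally show ?thesis .
qed

lemma closedin_conj_on:
  assumes "closedin (top_of_set K) {x \<in> K. P x}" "closedin (top_of_set K) {x \<in> K. Q x}"
  shows "closedin (top_of_set K) {x \<in> K. P x \<and> Q x}"
proof -
  have "{x \<in> K. P x \<and> Q x} = {x \<in> K. P x} \<inter> {x \<in> K. Q x}" by auto
  then show ?thesis using closedin_Int[OF assms] by simp
qed

lemma closedin_eq_on:
  fixes f g :: "'x::topological_space \<Rightarrow> real"
  assumes "continuous_on K f" "continuous_on K g"
  shows "closedin (top_of_set K) {x \<in> K. f x = g x}"
proof -
  have "closedin (top_of_set K) {x \<in> K. f x \<le> g x \<and> g x \<le> f x}"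
    by (intro closedin_conj_on closedin_le_on assms)
  then show ?thesis by (simp flip: order_eq_iff)
qed

lemma closedin_all_on:
  assumes "\<And>i. closedin (top_of_set K) {x \<in> K. P i x}"
  shows "closedin (top_of_set K) {x \<in> K. \<forall>i. P i x}"
proof -
  have "{x \<in> K. \<forall>i. P i x} = (\<Inter>i. {x \<in> K. P i x})" by auto
  moreover have "closedin (top_of_set K) (\<Inter>i. {x \<in> K. P i x})"
    using assms by (intro closedin_INT) auto
  ultimately show ?thesis by simp
qed

lemma closedin_imp_on:
  assumes "A \<Longrightarrow> closedin (top_of_set K) {x \<in> K. P x}"
  shows "closedin (top_of_set K) {x \<in> K. A \<longrightarrow> P x}"
  using assms by (cases A) auto

lemma closedin_Ball_on:
  assumes "\<And>i. i \<in> B \<Longrightarrow> closedin (top_of_set K) {x \<in> K. P i x}"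
  shows "closedin (top_of_set K) {x \<in> K. \<forall>i\<in>B. P i x}"
  unfolding Ball_def by (intro closedin_all_on closedin_imp_on assms)

lemmas closedin_on_intros = closedin_le_on closedin_eq_on closedin_conj_on closedin_all_on
  closedin_imp_on closedin_Ball_on

lemma continuous_on_apply:
  assumes "continuous_on S f"
  shows "continuous_on S (\<lambda>x. f x i)"
  using assms by (rule continuous_on_product_then_coordinatewise)

lemma continuous_on_coordinate: "continuous_on S (\<lambda>x. x i)"
  by (rule continuous_on_apply[OF continuous_on_id])

lemma compact_simplex: "compact (range (pmf :: 'a::finite pmf \<Rightarrow> _))"
proof -
  let ?B = "{q :: 'a \<Rightarrow> real. \<forall>x. q x \<in> {0..1}}"
  have "closedin (top_of_set ?B) {q \<in> ?B. (\<Sum>x\<in>UNIV. q x) = 1}"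
    by (intro closedin_on_intros continuous_on_sum continuous_on_coordinate continuous_on_const)
  then have "compact {q \<in> ?B. (\<Sum>x\<in>UNIV. q x) = 1}"
    by (rule closedin_compact[OF compact_functions[OF compact_Icc]])
  then show ?thesis
    by (simp add: range_pmf_simplex)
qed

text \<open>
  A family of decision rules, in the coordinates in which it depends continuously on its weights.
\<close>

definition pmf_families :: "('i \<Rightarrow> 'a \<Rightarrow> real) set" where
  "pmf_families = {p. \<forall>i. p i \<in> range pmf}"

lemma compact_pmf_families: "compact (pmf_families :: ('i \<Rightarrow> 'a::finite \<Rightarrow> real) set)"
  unfolding pmf_families_def by (intro compact_functions compact_simplex)

lemma continuous_on_inv_pmf:
  fixes p :: "'x::topological_space \<Rightarrow> 'a \<Rightarrow> real"
  assumes "continuous_on K p" "\<And>x. x \<in> K \<Longrightarrow> p x \<in> range pmf"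
  shows "continuous_on K (\<lambda>x. pmf (inv pmf (p x)) a)"
proof -
  have "continuous_on K (\<lambda>x. p x a)"
    by (rule continuous_on_apply[OF assms(1)])
  then show ?thesis
    by (rule continuous_on_cong[THEN iffD1, OF refl, rotated]) (use assms(2) in \<open>simp add: f_inv_into_f\<close>)
qed

lemma inj_pmf: "inj pmf"
  by (rule injI, rule pmf_eqI) simp

section \<open>Laws of lists grown one entry at a time\<close>

text \<open>
  Both the trajectories of the POMDP and those of the MDP are lists to which one entry is appended
  per step. Earlier entries are never changed, so the expected sum of stage rewards depends only
  on the laws of the entries taken one at a time.
\<close>

locale sequential_law =
  fixes X :: "nat \<Rightarrow> 'x::finite list pmf"
    and I :: "'x pmf"
    and K :: "nat \<Rightarrow> 'x list \<Rightarrow> 'x pmf"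
  assumes law_0: "X 0 = map_pmf (\<lambda>x. [x]) I"
    and law_Suc: "X (Suc t) = X t \<bind> (\<lambda>\<omega>. map_pmf (\<lambda>x. \<omega> @ [x]) (K t \<omega>))"
begin

lemma length_law: "\<omega> \<in> set_pmf (X t) \<Longrightarrow> length \<omega> = Suc t"
  by (induction t arbitrary: \<omega>) (auto simp: law_0 law_Suc)

lemma finite_law: "finite (set_pmf (X t))"
proof (rule finite_subset)
  show "set_pmf (X t) \<subseteq> {\<omega>. set \<omega> \<subseteq> UNIV \<and> length \<omega> = Suc t}"
    by (auto simp: length_law)
qed (rule finite_lists_length_eq, simp)

text \<open>
  Appending entries after time \<open>t\<close> does not alter entry \<open>t\<close>, which was the last one when it was drawn.
\<close>

lemma map_nth_law: "t \<le> T \<Longrightarrow> map_pmf (\<lambda>\<omega>. \<omega> ! t) (X T) = map_pmf last (X t)"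
proof (induction T rule: dec_induct)
  case base
  show ?case
  proof (rule map_pmf_cong)
    fix \<omega> assume "\<omega> \<in> set_pmf (X t)"
    then have "length \<omega> = Suc t" by (rule length_law)
    then show "\<omega> ! t = last \<omega>" by (cases \<omega> rule: rev_cases) auto
  qed simp
next
  case (step T)
  have "map_pmf (\<lambda>\<omega>. \<omega> ! t) (X (Suc T)) =
      X T \<bind> (\<lambda>\<omega>. map_pmf (\<lambda>x. (\<omega> @ [x]) ! t) (K T \<omega>))"
    by (simp add: law_Suc map_bind_pmf pmf.map_comp o_def)
  also have "\<dots> = X T \<bind> (\<lambda>\<omega>. return_pmf (\<omega> ! t))"
    using step.hyps by (intro bind_pmf_cong refl) (auto dest!: length_law simp: nth_append)
  finally show ?case
    using step.IH by (simp add: map_pmf_def)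
qed

lemma map_last_law_0: "map_pmf last (X 0) = I"
  by (simp add: law_0 pmf.map_comp o_def)

lemma map_last_law_Suc: "map_pmf last (X (Suc t)) = X t \<bind> K t"
  by (simp add: law_Suc map_bind_pmf pmf.map_comp o_def)

lemma expectation_sum_law:
  fixes f :: "nat \<Rightarrow> 'x \<Rightarrow> real"
  shows "measure_pmf.expectation (X T) (\<lambda>\<omega>. \<Sum>t=0..T. f t (\<omega> ! t)) =
    (\<Sum>t=0..T. \<Sum>x\<in>UNIV. f t x * pmf (map_pmf last (X t)) x)"
proof -
  have "measure_pmf.expectation (X T) (\<lambda>\<omega>. f t (\<omega> ! t)) =
      (\<Sum>x\<in>UNIV. f t x * pmf (map_pmf last (X t)) x)" if "t \<le> T" for t
  proof -
    have "measure_pmf.expectation (X T) (\<lambda>\<omega>. f t (\<omega> ! t)) =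
        measure_pmf.expectation (map_pmf last (X t)) (f t)"
      by (simp flip: map_nth_law[OF that])
    also have "\<dots> = (\<Sum>x\<in>UNIV. f t x * pmf (map_pmf last (X t)) x)"
      by (rule integral_measure_pmf_real) auto
    finally show ?thesis .
  qed
  then show ?thesis
    by (simp add: integrable_measure_pmf_finite finite_law)
qed

lemma expectation_sum_lists:
  "measure_pmf.expectation (X T) g = (\<Sum>\<omega> | length \<omega> = Suc T. g \<omega> * pmf (X T) \<omega>)"
  using finite_lists_length_eq[of "UNIV :: 'x set" "Suc T"]
  by (intro integral_measure_pmf_real) (auto simp: length_law)

end

text \<open>
  The multiplication rule: when the outcome determines both the first draw \<open>x\<close> and the second draw
  \<open>y\<close>, only the branch of \<open>x\<close> contributes.
\<close>

lemma pmf_bind_map: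
  assumes inj: "\<And>x y x' y'. f x y = f x' y' \<longleftrightarrow> x = x' \<and> y = y'"
  shows "pmf (A \<bind> (\<lambda>x. map_pmf (f x) (B x))) (f x y) = pmf A x * pmf (B x) y"
proof -
  have "pmf (map_pmf (f x') (B x')) (f x y) = indicator {x} x' * pmf (B x) y" for x'
  proof (cases "x' = x")
    case True
    have "inj (f x)" by (auto intro: injI simp: inj)
    then show ?thesis by (simp add: True pmf_map_inj')
  next
    case False
    then show ?thesis by (auto intro!: pmf_map_outside simp: inj)
  qed
  then show ?thesis
    by (simp add: pmf_bind measure_pmf_single)
qed

lemma (in sequential_law) pmf_law_snoc: "pmf (X (Suc t)) (\<omega> @ [x]) = pmf (X t) \<omega> * pmf (K t \<omega>) x"
  unfolding law_Suc by (rule pmf_bind_map) auto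

lemma (in sequential_law) pmf_law_Nil: "pmf (X t) [] = 0"
  by (auto simp: pmf_eq_0_set_pmf dest: length_law)

section \<open>Trajectories\<close>

definition obs_act :: "('s, 'o, 'a) pomdp \<Rightarrow> ('o \<Rightarrow> 'a pmf) \<Rightarrow> 's pmf \<Rightarrow> ('s \<times> 'o \<times> 'a) pmf" where
  "obs_act M d \<sigma> = \<sigma> \<bind> (\<lambda>s. obs M s \<bind> (\<lambda>ob. map_pmf (\<lambda>a. (s, ob, a)) (d ob)))"

lemma pmf_obs_act: "pmf (obs_act M d \<sigma>) (s, ob, a) = pmf \<sigma> s * pmf (obs M s) ob * pmf (d ob) a"
proof -
  have "pmf (obs_act M d \<sigma>) (s, ob, a) =
    pmf (\<sigma> \<bind> (\<lambda>s. map_pmf (Pair s) (obs M s \<bind> (\<lambda>ob. map_pmf (Pair ob) (d ob))))) (s, ob, a)"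
    by (simp add: obs_act_def map_bind_pmf pmf.map_comp o_def)
  then show ?thesis
    by (simp add: pmf_bind_map[of Pair] mult.assoc)
qed

lemma trajectory_sequential:
  "sequential_law (trajectory M b \<delta>) (obs_act M (\<delta> 0 []) b)
    (\<lambda>t \<omega>. obs_act M (\<delta> (Suc t) (map snd \<omega>)) (case last \<omega> of (s', ob', a') \<Rightarrow> step M s' a'))"
  for M :: "('s::finite, 'o::finite, 'a::finite) pomdp"
  by unfold_locales
    (simp_all add: obs_act_def map_bind_pmf pmf.map_comp o_def, simp_all add: map_pmf_def)

lemma mdp_trajectory_sequential:
  "sequential_law (mdp_trajectory M b \<pi>) (b \<bind> (\<lambda>s. map_pmf (Pair s) (\<pi> 0 s)))
    (\<lambda>t \<omega>. (case last \<omega> of (s', a') \<Rightarrow> step M s' a') \<bind> (\<lambda>s. map_pmf (Pair s) (\<pi> (Suc t) s)))"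
  for M :: "('s::finite, 'o::finite, 'a::finite) pomdp"
  by unfold_locales
    (simp_all add: map_bind_pmf pmf.map_comp o_def, simp_all add: map_pmf_def)

text \<open>
  By the multiplication rule the probability of a trajectory is a polynomial in the finitely many
  policy weights that it meets.
\<close>

lemma continuous_on_pmf_trajectory:
  fixes M :: "('s::finite, 'o::finite, 'a::finite) pomdp"
    and D :: "'x::topological_space \<Rightarrow> ('o, 'a) hist_policy"
  assumes "\<And>t h ob a. continuous_on K (\<lambda>x. pmf (D x t h ob) a)"
  shows "continuous_on K (\<lambda>x. pmf (trajectory M b (D x) t) \<omega>)"
proof (induction t arbitrary: \<omega>)
  case 0
  have "continuous_on K (\<lambda>x. pmf (obs_act M (D x 0 []) b) y)" for y
    by (cases y) (simp add: pmf_obs_act continuous_intros assms)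
  moreover have "pmf (map_pmf (\<lambda>x. [x]) p) \<omega> = (case \<omega> of [y] \<Rightarrow> pmf p y | _ \<Rightarrow> 0)"
    for p :: "('s \<times> 'o \<times> 'a) pmf"
    by (auto simp: pmf_map_inj'[of "\<lambda>x. [x]"] inj_def intro!: pmf_map_outside split: list.split)
  ultimately show ?case
    unfolding sequential_law.law_0[OF trajectory_sequential]
    by (cases \<omega> rule: remdups_adj.cases) simp_all
next
  case (Suc t)
  show ?case
  proof (cases \<omega> rule: rev_cases)
    case Nil
    then show ?thesis by (simp add: sequential_law.pmf_law_Nil[OF trajectory_sequential]
      del: trajectory.simps)
  next
    case (snoc \<omega>' y)
    then show ?thesis
      by (cases y) (simp add: sequential_law.pmf_law_snoc[OF trajectory_sequential]
        pmf_obs_act continuous_intros assms Suc.IH del: trajectory.simps)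
  qed
qed

lemma continuous_on_expected_reward:
  fixes M :: "('s::finite, 'o::finite, 'a::finite) pomdp"
    and D :: "'x::topological_space \<Rightarrow> ('o, 'a) hist_policy"
  assumes "\<And>t h ob a. continuous_on K (\<lambda>x. pmf (D x t h ob) a)"
  shows "continuous_on K (\<lambda>x. expected_reward M T b a (D x))"
  unfolding expected_reward_def sequential_law.expectation_sum_lists[OF trajectory_sequential]
proof (intro continuous_intros continuous_on_pmf_trajectory)
  show "continuous_on K (\<lambda>x. pmf (force_initial a (D x) t h ob) a')" for t h ob a'
    by (cases "t = 0") (simp_all add: force_initial_def assms)
qed

text \<open>
  The parameter \<open>key\<close> says which part of the available information a policy may use; this covers
  memoryless and history-dependent policies together. The values are the union, over the finitely
  many forced actions, of continuous images of a product of simplices.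
\<close>

lemma compact_policy_values:
  fixes M :: "('s::finite, 'o::finite, 'a::finite) pomdp"
    and key :: "nat \<Rightarrow> ('o \<times> 'a) list \<Rightarrow> 'o \<Rightarrow> 'i"
  shows "compact {v. \<exists>a \<delta>. v = expected_reward M T b a (\<lambda>t h ob. \<delta> (key t h ob))}"
proof -
  define D where "D p = (\<lambda>t h ob. inv pmf (p (key t h ob)))" for p :: "'i \<Rightarrow> 'a \<Rightarrow> real"
  have D: "(\<lambda>t h ob. \<delta> (key t h ob)) = D (\<lambda>i. pmf (\<delta> i))" for \<delta>
    by (simp add: D_def inv_f_f inj_pmf)
  have "{v. \<exists>a \<delta>. v = expected_reward M T b a (\<lambda>t h ob. \<delta> (key t h ob))} =
      (\<Union>a. (\<lambda>p. expected_reward M T b a (D p)) ` pmf_families)"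
  proof (intro equalityI subsetI)
    fix v assume "v \<in> {v. \<exists>a \<delta>. v = expected_reward M T b a (\<lambda>t h ob. \<delta> (key t h ob))}"
    then obtain a \<delta> where "v = expected_reward M T b a (D (\<lambda>i. pmf (\<delta> i)))"
      unfolding D by blast
    moreover have "(\<lambda>i. pmf (\<delta> i)) \<in> pmf_families"
      by (simp add: pmf_families_def)
    ultimately show "v \<in> (\<Union>a. (\<lambda>p. expected_reward M T b a (D p)) ` pmf_families)"
      by blast
  next
    fix v assume "v \<in> (\<Union>a. (\<lambda>p. expected_reward M T b a (D p)) ` pmf_families)"
    then obtain a p where "v = expected_reward M T b a (D p)" by blast
    then show "v \<in> {v. \<exists>a \<delta>. v = expected_reward M T b a (\<lambda>t h ob. \<delta> (key t h ob))}"
      by (auto simp: D_def intro!: exI[of _ a] exI[of _ "\<lambda>i. inv pmf (p i)"])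
  qed
  moreover have "continuous_on pmf_families (\<lambda>p. pmf (D p t h ob) a)" for t h ob a
    unfolding D_def
    by (intro continuous_on_inv_pmf continuous_on_coordinate) (auto simp: pmf_families_def)
  ultimately show ?thesis
    by (auto intro!: compact_UN compact_continuous_image continuous_on_expected_reward
      compact_pmf_families)
qed

lemma compact_w_hist_values:
  fixes M :: "('s::finite, 'o::finite, 'a::finite) pomdp"
  shows "compact {v. \<exists>a (\<delta> :: ('o, 'a) hist_policy). v = expected_reward M T b a \<delta>}"
proof -
  have "(\<exists>\<delta> :: ('o, 'a) hist_policy. v = expected_reward M T b a \<delta>) \<longleftrightarrow>
      (\<exists>\<delta>. v = expected_reward M T b a (\<lambda>t h ob. \<delta> (t, h, ob)))" for v a
  proof
    assume "\<exists>\<delta> :: ('o, 'a) hist_policy. v = expected_reward M T b a \<delta>"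
    then obtain \<delta> :: "('o, 'a) hist_policy" where "v = expected_reward M T b a \<delta>" by blast
    then show "\<exists>\<delta>. v = expected_reward M T b a (\<lambda>t h ob. \<delta> (t, h, ob))"
      by (intro exI[of _ "\<lambda>(t, h, ob). \<delta> t h ob"]) simp
  qed blast
  then show ?thesis
    using compact_policy_values[of M T b "\<lambda>t h ob. (t, h, ob)"] by simp
qed

lemma compact_w_ml_values:
  fixes M :: "('s::finite, 'o::finite, 'a::finite) pomdp"
  shows "compact {v. \<exists>a (\<delta> :: ('o, 'a) ml_policy). v = expected_reward M T b a (hist_of_ml \<delta>)}"
proof -
  have "(\<exists>\<delta> :: ('o, 'a) ml_policy. v = expected_reward M T b a (hist_of_ml \<delta>)) \<longleftrightarrow>
      (\<exists>\<delta>. v = expected_reward M T b a (\<lambda>t h ob. \<delta> (t, ob)))" for v a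
  proof
    assume "\<exists>\<delta> :: ('o, 'a) ml_policy. v = expected_reward M T b a (hist_of_ml \<delta>)"
    then obtain \<delta> :: "('o, 'a) ml_policy" where "v = expected_reward M T b a (hist_of_ml \<delta>)"
      by blast
    then show "\<exists>\<delta>. v = expected_reward M T b a (\<lambda>t h ob. \<delta> (t, ob))"
      by (intro exI[of _ "\<lambda>(t, ob). \<delta> t ob"]) (simp add: hist_of_ml_def)
  next
    assume "\<exists>\<delta>. v = expected_reward M T b a (\<lambda>t h ob. \<delta> (t, ob))"
    then obtain \<delta> where "v = expected_reward M T b a (\<lambda>t h ob. \<delta> (t, ob))" by blast
    then show "\<exists>\<delta> :: ('o, 'a) ml_policy. v = expected_reward M T b a (hist_of_ml \<delta>)"
      by (intro exI[of _ "\<lambda>t ob. \<delta> (t, ob)"]) (simp add: hist_of_ml_def)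
  qed
  then show ?thesis
    using compact_policy_values[of M T b "\<lambda>t h ob. (t, ob)"] by simp
qed

section \<open>Compactness of the values of the linear relaxations\<close>

lemma closedin_relax_feasible:
  fixes \<mu> :: "'x::topological_space \<Rightarrow> ('s::finite, 'o::finite, 'a::finite) milp_vars"
  assumes "\<And>t s. continuous_on K (\<lambda>x. mu_s (\<mu> x) t s)"
    and "\<And>t s ob a. continuous_on K (\<lambda>x. mu_soa (\<mu> x) t s ob a)"
    and "\<And>t s a. continuous_on K (\<lambda>x. mu_sa (\<mu> x) t s a)"
    and "\<And>t ob a. continuous_on K (\<lambda>x. pmf (\<delta> x t ob) a)"
  shows "closedin (top_of_set K) {x \<in> K. relax_feasible M T b (\<mu> x) (\<delta> x)}"
  unfolding relax_feasible_def mccormick_def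
  by (intro closedin_on_intros continuous_intros assms)

lemma closedin_valid_ineqs:
  fixes \<mu> :: "'x::topological_space \<Rightarrow> ('s::finite, 'o::finite, 'a::finite) milp_vars"
  assumes "\<And>t s ob a. continuous_on K (\<lambda>x. mu_soa (\<mu> x) t s ob a)"
    and "\<And>t s a. continuous_on K (\<lambda>x. mu_sa (\<mu> x) t s a)"
    and "\<And>t s' a' s ob a. continuous_on K (\<lambda>x. \<nu> x t s' a' s ob a)"
  shows "closedin (top_of_set K) {x \<in> K. valid_ineqs M T (\<mu> x) (\<nu> x)}"
  unfolding valid_ineqs_def
  by (intro closedin_on_intros continuous_intros assms)

lemma relax_feasibleD:
  assumes "relax_feasible M T b \<mu> \<delta>"
  shows "mu_s \<mu> 0 s = pmf b s"
    and "t \<le> T \<Longrightarrow> mu_s \<mu> t s = (\<Sum>a\<in>UNIV. mu_sa \<mu> t s a)"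
    and "t \<le> T \<Longrightarrow> mu_sa \<mu> t s a = (\<Sum>ob\<in>UNIV. mu_soa \<mu> t s ob a)"
    and "t \<le> T \<Longrightarrow> mu_s \<mu> (Suc t) s =
      (\<Sum>s'\<in>UNIV. \<Sum>a'\<in>UNIV. pmf (step M s' a') s * mu_sa \<mu> t s' a')"
    and "t \<le> Suc T \<Longrightarrow> mu_s \<mu> t s \<ge> 0"
    and "t \<le> T \<Longrightarrow> mu_sa \<mu> t s a \<ge> 0"
    and "t \<le> T \<Longrightarrow> mu_soa \<mu> t s ob a \<ge> 0"
proof -
  note c = assms[unfolded relax_feasible_def, THEN conjunct2]
  note d = c[THEN conjunct2]
  note e = d[THEN conjunct2, THEN conjunct2, THEN conjunct2, THEN conjunct2]
  show "mu_s \<mu> 0 s = pmf b s"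
    by (rule c[THEN conjunct1, rule_format])
  show "t \<le> T \<Longrightarrow> mu_s \<mu> t s = (\<Sum>a\<in>UNIV. mu_sa \<mu> t s a)"
    by (rule d[THEN conjunct1, rule_format])
  show "t \<le> T \<Longrightarrow> mu_sa \<mu> t s a = (\<Sum>ob\<in>UNIV. mu_soa \<mu> t s ob a)"
    by (rule d[THEN conjunct2, THEN conjunct1, rule_format])
  show "t \<le> T \<Longrightarrow> mu_s \<mu> (Suc t) s =
      (\<Sum>s'\<in>UNIV. \<Sum>a'\<in>UNIV. pmf (step M s' a') s * mu_sa \<mu> t s' a')"
    by (rule d[THEN conjunct2, THEN conjunct2, THEN conjunct1, rule_format])
  show "t \<le> Suc T \<Longrightarrow> mu_s \<mu> t s \<ge> 0"
    by (rule e[THEN conjunct1, rule_format])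
  show "t \<le> T \<Longrightarrow> mu_sa \<mu> t s a \<ge> 0"
    by (rule e[THEN conjunct2, THEN conjunct2, rule_format])
  show "t \<le> T \<Longrightarrow> mu_soa \<mu> t s ob a \<ge> 0"
    by (rule e[THEN conjunct2, THEN conjunct1, rule_format])
qed

text \<open>
  Total state mass is preserved by the flow constraint and stays equal to 1; every other variable
  is a summand of some state mass.
\<close>

lemma relax_feasible_le_1:
  assumes "relax_feasible M T b \<mu> \<delta>"
  shows "t \<le> Suc T \<Longrightarrow> mu_s \<mu> t s \<le> 1"
    and "t \<le> T \<Longrightarrow> mu_sa \<mu> t s a \<le> 1"
    and "t \<le> T \<Longrightarrow> mu_soa \<mu> t s ob a \<le> 1"
proof -
  note f = relax_feasibleD[OF assms]
  have total: "(\<Sum>s\<in>UNIV. mu_s \<mu> t s) = 1" if "t \<le> Suc T" for t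
    using that
  proof (induction t)
    case 0
    then show ?case by (simp add: f(1) sum_pmf_UNIV)
  next
    case (Suc t)
    then have t: "t \<le> T" by simp
    have "(\<Sum>s\<in>UNIV. mu_s \<mu> (Suc t) s) =
        (\<Sum>s\<in>UNIV. \<Sum>s'\<in>UNIV. \<Sum>a'\<in>UNIV. pmf (step M s' a') s * mu_sa \<mu> t s' a')"
      by (simp add: f(4)[OF t])
    also have "\<dots> = (\<Sum>s'\<in>UNIV. \<Sum>s\<in>UNIV. \<Sum>a'\<in>UNIV. pmf (step M s' a') s * mu_sa \<mu> t s' a')"
      by (rule sum.swap)
    also have "\<dots> = (\<Sum>s'\<in>UNIV. \<Sum>a'\<in>UNIV. \<Sum>s\<in>UNIV. pmf (step M s' a') s * mu_sa \<mu> t s' a')"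
      by (intro sum.cong refl sum.swap)
    also have "\<dots> = (\<Sum>s'\<in>UNIV. mu_s \<mu> t s')"
      by (simp add: sum_pmf_UNIV f(2)[OF t, symmetric] flip: sum_distrib_right)
    finally show ?case using Suc by simp
  qed
  show s: "mu_s \<mu> t s \<le> 1" if "t \<le> Suc T" for t s
    unfolding total[OF that, symmetric] by (rule member_le_sum) (simp_all add: f(5)[OF that])
  show sa: "mu_sa \<mu> t s a \<le> 1" if "t \<le> T" for t s a
  proof -
    have "mu_sa \<mu> t s a \<le> mu_s \<mu> t s"
      unfolding f(2)[OF that] by (rule member_le_sum) (simp_all add: f(6)[OF that])
    then show ?thesis using s[of t s] that by simp
  qed
  show "mu_soa \<mu> t s ob a \<le> 1" if "t \<le> T"
  proof -
    have "mu_soa \<mu> t s ob a \<le> mu_sa \<mu> t s a"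
      unfolding f(3)[OF that]
      by (rule member_le_sum[where f = "\<lambda>ob. mu_soa \<mu> t s ob a"]) (simp_all add: f(7)[OF that])
    then show ?thesis using sa[of t s a] that by simp
  qed
qed

lemma valid_ineqs_bounds:
  assumes feas: "relax_feasible M T b \<mu> \<delta>" and valid: "valid_ineqs M T \<mu> \<nu>" and t: "t \<in> {1..T}"
  shows "0 \<le> \<nu> t s' a' s ob a" "\<nu> t s' a' s ob a \<le> 1"
proof -
  show nonneg: "0 \<le> \<nu> t s' a' s ob a" for s' a'
    using valid t unfolding valid_ineqs_def by blast
  have "\<nu> t s' a' s ob a \<le> (\<Sum>a'\<in>UNIV. \<nu> t s' a' s ob a)"
    using nonneg by (intro member_le_sum) auto
  also have "\<dots> \<le> (\<Sum>s'\<in>UNIV. \<Sum>a'\<in>UNIV. \<nu> t s' a' s ob a)"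
    using nonneg by (intro member_le_sum[where f = "\<lambda>s'. \<Sum>a'\<in>UNIV. \<nu> t s' a' s ob a"] sum_nonneg) auto
  also have "\<dots> = mu_soa \<mu> t s ob a"
    using valid t unfolding valid_ineqs_def by blast
  also have "\<dots> \<le> 1"
    using relax_feasible_le_1(3)[OF feas] t by auto
  finally show "\<nu> t s' a' s ob a \<le> 1" .
qed

text \<open>
  Entries beyond the horizon are unconstrained and may be unbounded. Replacing them by 0 changes
  neither feasibility nor the objective, and it moves every feasible \<open>\<mu>\<close> into the unit cube.
  The state mass is constrained up to \<open>T + 1\<close>, one step further than the rest.
\<close>

definition cut_vars :: "nat \<Rightarrow> ('s, 'o, 'a) milp_vars \<Rightarrow> ('s, 'o, 'a) milp_vars" where
  "cut_vars T \<mu> =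
    \<lparr>mu_s = \<lambda>t s. if t \<le> Suc T then mu_s \<mu> t s else 0,
     mu_soa = \<lambda>t s ob a. if t \<le> T then mu_soa \<mu> t s ob a else 0,
     mu_sa = \<lambda>t s a. if t \<le> T then mu_sa \<mu> t s a else 0\<rparr>"

lemma relax_feasible_cut_vars: "relax_feasible M T b (cut_vars T \<mu>) \<delta> \<longleftrightarrow> relax_feasible M T b \<mu> \<delta>"
  unfolding relax_feasible_def mccormick_def cut_vars_def
  by (intro conj_cong all_cong1 imp_cong refl) simp_all

lemma valid_ineqs_cut_vars:
  "valid_ineqs M T (cut_vars T \<mu>) (\<lambda>t s' a' s ob a. if t \<in> {1..T} then \<nu> t s' a' s ob a else 0)
    \<longleftrightarrow> valid_ineqs M T \<mu> \<nu>"
  unfolding valid_ineqs_def cut_vars_def by (intro ball_cong conj_cong all_cong1 refl) auto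

lemma milp_objective_cut_vars: "milp_objective M T (cut_vars T \<mu>) = milp_objective M T \<mu>"
  by (simp add: milp_objective_def cut_vars_def)

text \<open>
  A feasible solution as a point of a space with a topology: the policy, the three families of
  \<open>\<mu>\<close>, and the variables of (V), in this order. Index tuples are uncurried so that each component
  lives in a single product of intervals.
\<close>

type_synonym ('s, 'o, 'a) lp_point =
  "(nat \<times> 'o \<Rightarrow> 'a \<Rightarrow> real) \<times> (nat \<times> 's \<Rightarrow> real) \<times> (nat \<times> 's \<times> 'o \<times> 'a \<Rightarrow> real) \<times>
    (nat \<times> 's \<times> 'a \<Rightarrow> real) \<times> (nat \<times> 's \<times> 'a \<times> 's \<times> 'o \<times> 'a \<Rightarrow> real)"

text \<open>
  The flag \<open>cuts\<close> switches the inequalities (V) on, so both relaxations are treated at once. The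
  feasible points form a closed subset of the product of the policy simplices with a cube, and the
  objective is continuous.
\<close>

lemma compact_relaxation_values:
  fixes M :: "('s::finite, 'o::finite, 'a::finite) pomdp"
  shows "compact {v. \<exists>\<mu> \<delta> \<nu>. relax_feasible M T b \<mu> \<delta> \<and> (cuts \<longrightarrow> valid_ineqs M T \<mu> \<nu>) \<and>
    v = milp_objective M T \<mu>}" (is "compact ?V")
proof -
  define B :: "('s, 'o, 'a) lp_point set"
    where "B = pmf_families \<times> {f. \<forall>i. f i \<in> {0..1}} \<times> {f. \<forall>i. f i \<in> {0..1}} \<times>
      {f. \<forall>i. f i \<in> {0..1}} \<times> {f. \<forall>i. f i \<in> {0..1}}"
  define pol where "pol x = (\<lambda>t ob. inv pmf (fst x (t, ob)))"
    for x :: "('s, 'o, 'a) lp_point"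
  define vars where "vars x =
    \<lparr>mu_s = \<lambda>t s. fst (snd x) (t, s), mu_soa = \<lambda>t s ob a. fst (snd (snd x)) (t, s, ob, a),
     mu_sa = \<lambda>t s a. fst (snd (snd (snd x))) (t, s, a)\<rparr>"
    for x :: "('s, 'o, 'a) lp_point"
  define tr where "tr x = (\<lambda>t s' a' s ob a. snd (snd (snd (snd x))) (t, s', a', s, ob, a))"
    for x :: "('s, 'o, 'a) lp_point"
  define F where "F = {x \<in> B. relax_feasible M T b (vars x) (pol x) \<and>
    (cuts \<longrightarrow> valid_ineqs M T (vars x) (tr x))}"
  have "compact B"
    unfolding B_def by (intro compact_Times compact_pmf_families compact_functions compact_Icc)
  have cont_pol: "continuous_on B (\<lambda>x. pmf (pol x t ob) a)" for t ob a
    unfolding pol_def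
    by (intro continuous_on_inv_pmf continuous_on_apply[OF continuous_on_fst[OF continuous_on_id]])
      (auto simp: B_def pmf_families_def)
  have cont_vars: "continuous_on B (\<lambda>x. mu_s (vars x) t s)"
    "continuous_on B (\<lambda>x. mu_soa (vars x) t s ob a)"
    "continuous_on B (\<lambda>x. mu_sa (vars x) t s a)" for t s ob a
    by (simp_all add: vars_def)
      (rule continuous_on_apply, intro continuous_on_fst continuous_on_snd continuous_on_id)+
  have cont_tr: "continuous_on B (\<lambda>x. tr x t s' a' s ob a)" for t s' a' s ob a
    unfolding tr_def
    by (rule continuous_on_apply, intro continuous_on_snd continuous_on_id)
  have "closedin (top_of_set B) F"
    unfolding F_def
    by (intro closedin_on_intros closedin_relax_feasible closedin_valid_ineqs
        cont_pol cont_vars cont_tr)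
  then have "compact F"
    by (rule closedin_compact[OF \<open>compact B\<close>])
  moreover have "continuous_on B (\<lambda>x. milp_objective M T (vars x))"
    unfolding milp_objective_def by (intro continuous_intros cont_vars)
  then have "continuous_on F (\<lambda>x. milp_objective M T (vars x))"
    by (rule continuous_on_subset) (auto simp: F_def)
  ultimately have "compact ((\<lambda>x. milp_objective M T (vars x)) ` F)"
    by (intro compact_continuous_image)
  also have "(\<lambda>x. milp_objective M T (vars x)) ` F = ?V"
  proof (intro equalityI subsetI)
    fix v assume "v \<in> ?V"
    then obtain \<mu> \<delta> \<nu> where feas: "relax_feasible M T b \<mu> \<delta>"
      and cuts: "cuts \<Longrightarrow> valid_ineqs M T \<mu> \<nu>" and v: "v = milp_objective M T \<mu>"
      by blast
    (* without (V) the variables \<nu> are arbitrary, hence possibly outside the cube: take 0 *)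
    define x where "x = (\<lambda>(t, ob). pmf (\<delta> t ob), \<lambda>(t, s). mu_s (cut_vars T \<mu>) t s,
      \<lambda>(t, s, ob, a). mu_soa (cut_vars T \<mu>) t s ob a, \<lambda>(t, s, a). mu_sa (cut_vars T \<mu>) t s a,
      \<lambda>(t, s', a', s, ob, a). if cuts then if t \<in> {1..T} then \<nu> t s' a' s ob a else 0 else 0)"
    have vars: "vars x = cut_vars T \<mu>"
      by (simp add: vars_def x_def)
    have pol: "pol x = \<delta>"
      by (simp add: pol_def x_def inv_f_f inj_pmf)
    have tr: "tr x = (\<lambda>t s' a' s ob a. if t \<in> {1..T} then \<nu> t s' a' s ob a else 0)" if cuts
      using that by (simp add: tr_def x_def)
    have "x \<in> B"
      unfolding B_def x_def pmf_families_def
      using relax_feasibleD(5-7)[OF feas] relax_feasible_le_1[OF feas]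
        valid_ineqs_bounds[OF feas cuts]
      by (auto simp: cut_vars_def)
    then have "x \<in> F"
      using feas cuts
      by (auto simp: F_def vars pol tr relax_feasible_cut_vars valid_ineqs_cut_vars
        simp del: atLeastAtMost_iff One_nat_def)
    then show "v \<in> (\<lambda>x. milp_objective M T (vars x)) ` F"
      by (auto simp: v vars milp_objective_cut_vars intro!: image_eqI[where x = x])
  qed (auto simp: F_def)
  finally show ?thesis .
qed

section \<open>Feasible solutions from laws of state, observation and action\<close>

lemma pmf_bind_finite: "pmf (p \<bind> f) y = (\<Sum>x\<in>UNIV. pmf p x * pmf (f x) y)"
  for p :: "'x::finite pmf"
  unfolding pmf_bind by (subst integral_measure_pmf_real[of UNIV]) (auto simp: mult.commute)

lemma sum_UNIV_prod: "(\<Sum>x\<in>UNIV. f x) = (\<Sum>x\<in>UNIV. \<Sum>y\<in>UNIV. f (x, y))"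
  by (simp add: sum.cartesian_product' flip: UNIV_Times_UNIV)

lemma pmf_le_pmf_map: "pmf p x \<le> pmf (map_pmf f p) (f x)"
proof -
  have "measure p {x} \<le> measure p (f -` {f x})"
    by (intro measure_pmf.finite_measure_mono) auto
  then show ?thesis by (simp add: pmf_map measure_pmf_single)
qed

definition law_vars :: "(nat \<Rightarrow> 's pmf) \<Rightarrow> (nat \<Rightarrow> ('s \<times> 'o \<times> 'a) pmf) \<Rightarrow> ('s, 'o::finite, 'a) milp_vars"
  where "law_vars \<sigma> L =
    \<lparr>mu_s = \<lambda>t s. pmf (\<sigma> t) s, mu_soa = \<lambda>t s ob a. pmf (L t) (s, ob, a),
     mu_sa = \<lambda>t s a. \<Sum>ob\<in>UNIV. pmf (L t) (s, ob, a)\<rparr>"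

text \<open>
  The policy chosen for the McCormick constraints is the law of the action alone, whatever the
  observation. A joint probability is at most the probability of its action, which is the bound
  \<open>\<mu>\<^sub>s\<^sub>o\<^sub>a \<le> \<delta>\<^sub>a\<^sub>|\<^sub>o\<close>. The lower bound follows from the upper bounds for the other actions: both
  \<open>p(o|s)\<mu>\<^sub>s - \<mu>\<^sub>s\<^sub>o\<^sub>a\<close> and \<open>1 - \<delta>\<^sub>a\<^sub>|\<^sub>o\<close> are sums over those actions. Being independent of the
  observation, this policy also meets the condition at time 0. Hence every process with the
  initial belief, observation kernel and transitions of the model is feasible, however its actions are chosen.
\<close>

lemma relax_feasible_law_vars:
  fixes M :: "('s::finite, 'o::finite, 'a::finite) pomdp"
  assumes init: "\<sigma> 0 = b"
    and flow: "\<And>t. \<sigma> (Suc t) = L t \<bind> (\<lambda>(s, ob, a). step M s a)"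
    and obs: "\<And>t s ob. (\<Sum>a\<in>UNIV. pmf (L t) (s, ob, a)) = pmf (\<sigma> t) s * pmf (obs M s) ob"
  shows "relax_feasible M T b (law_vars \<sigma> L) (\<lambda>t ob. map_pmf (snd \<circ> snd) (L t))"
proof -
  let ?d = "\<lambda>t. map_pmf (snd \<circ> snd) (L t)"
  have le_d: "pmf (L t) (s, ob, a) \<le> pmf (?d t) a" for t s ob a
    using pmf_le_pmf_map[of "L t" "(s, ob, a)" "snd \<circ> snd"] by simp
  have mass: "pmf (\<sigma> t) s = (\<Sum>a\<in>UNIV. \<Sum>ob\<in>UNIV. pmf (L t) (s, ob, a))" for t s
    by (subst sum.swap) (simp add: obs sum_pmf_UNIV flip: sum_distrib_left)
  have le_obs: "pmf (L t) (s, ob, a) \<le> pmf (obs M s) ob * pmf (\<sigma> t) s" for t s ob a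
    using member_le_sum[of a UNIV "\<lambda>a. pmf (L t) (s, ob, a)"] by (simp add: obs mult.commute)
  have lower: "pmf (obs M s) ob * pmf (\<sigma> t) s + pmf (?d t) a - 1 \<le> pmf (L t) (s, ob, a)" for t s ob a
  proof -
    have "pmf (obs M s) ob * pmf (\<sigma> t) s =
        pmf (L t) (s, ob, a) + (\<Sum>a'\<in>UNIV - {a}. pmf (L t) (s, ob, a'))"
      by (subst sum.remove[symmetric]) (auto simp: obs)
    also have "\<dots> \<le> pmf (L t) (s, ob, a) + (\<Sum>a'\<in>UNIV - {a}. pmf (?d t) a')"
      by (intro add_left_mono sum_mono le_d)
    also have "(\<Sum>a'\<in>UNIV - {a}. pmf (?d t) a') = 1 - pmf (?d t) a"
      using sum.remove[of UNIV a "pmf (?d t)"] by (simp add: sum_pmf_UNIV)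
    finally show ?thesis by simp
  qed
  have flow': "pmf (\<sigma> (Suc t)) s = (\<Sum>s'\<in>UNIV. \<Sum>a'\<in>UNIV.
      pmf (step M s' a') s * (\<Sum>ob\<in>UNIV. pmf (L t) (s', ob, a')))" for t s
  proof -
    have "pmf (\<sigma> (Suc t)) s =
        (\<Sum>s'\<in>UNIV. \<Sum>ob\<in>UNIV. \<Sum>a'\<in>UNIV. pmf (L t) (s', ob, a') * pmf (step M s' a') s)"
      by (simp add: flow pmf_bind_finite sum_UNIV_prod)
    also have "\<dots> = (\<Sum>s'\<in>UNIV. \<Sum>a'\<in>UNIV. \<Sum>ob\<in>UNIV. pmf (L t) (s', ob, a') * pmf (step M s' a') s)"
      by (intro sum.cong refl sum.swap)
    finally show ?thesis
      by (simp add: sum_distrib_left mult.commute)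
  qed
  show ?thesis
    unfolding relax_feasible_def mccormick_def law_vars_def
    using init mass flow' le_d le_obs lower by (auto intro!: sum_nonneg)
qed

lemma milp_objective_law_vars:
  fixes M :: "('s::finite, 'o::finite, 'a::finite) pomdp"
  shows "milp_objective M T (law_vars \<sigma> L) =
    (\<Sum>t=0..T. \<Sum>x\<in>UNIV. (case x of (s, ob, a) \<Rightarrow> reward M t s a) * pmf (L t) x)"
proof -
  have "(\<Sum>a\<in>UNIV. \<Sum>ob\<in>UNIV. reward M t s a * pmf (L t) (s, ob, a)) =
      (\<Sum>ob\<in>UNIV. \<Sum>a\<in>UNIV. reward M t s a * pmf (L t) (s, ob, a))" for t s
    by (rule sum.swap)
  then show ?thesis
    by (simp add: milp_objective_def law_vars_def sum_UNIV_prod sum_distrib_left)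
qed

section \<open>The relaxation and the MDP approximation\<close>

definition mdp_occ :: "('s, 'o, 'a) pomdp \<Rightarrow> 's pmf \<Rightarrow> ('s, 'a) mdp_policy \<Rightarrow> nat \<Rightarrow> ('s \<times> 'a) pmf"
  where "mdp_occ M b \<pi> t = map_pmf last (mdp_trajectory M b \<pi> t)"

definition mdp_state where
  "mdp_state M b \<pi> t = (case t of 0 \<Rightarrow> b | Suc t \<Rightarrow> mdp_occ M b \<pi> t \<bind> (\<lambda>(s, a). step M s a))"

lemma mdp_occ_eq:
  fixes M :: "('s::finite, 'o::finite, 'a::finite) pomdp"
  shows "mdp_occ M b \<pi> t = mdp_state M b \<pi> t \<bind> (\<lambda>s. map_pmf (Pair s) (\<pi> t s))"
  unfolding mdp_occ_def
  by (cases t) (simp_all add: sequential_law.map_last_law_0[OF mdp_trajectory_sequential]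
    sequential_law.map_last_law_Suc[OF mdp_trajectory_sequential]
    mdp_state_def mdp_occ_def bind_assoc_pmf bind_map_pmf del: mdp_trajectory.simps)

lemma pmf_mdp_occ:
  fixes M :: "('s::finite, 'o::finite, 'a::finite) pomdp"
  shows "pmf (mdp_occ M b \<pi> t) (s, a) = pmf (mdp_state M b \<pi> t) s * pmf (\<pi> t s) a"
  unfolding mdp_occ_eq by (rule pmf_bind_map) simp

lemma mdp_objective_eq:
  fixes M :: "('s::finite, 'o::finite, 'a::finite) pomdp"
  shows "mdp_objective M T b \<pi> =
    (\<Sum>t=0..T. \<Sum>s\<in>UNIV. \<Sum>a\<in>UNIV. reward M t s a * pmf (mdp_occ M b \<pi> t) (s, a))"
  unfolding mdp_objective_def mdp_occ_def
  by (subst sequential_law.expectation_sum_law[OF mdp_trajectory_sequential,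
      where f = "\<lambda>t (s, a). reward M t s a"]) (simp add: sum_UNIV_prod)

text \<open>
  The conditional probabilities \<open>\<mu>\<^sub>s\<^sub>a / \<mu>\<^sub>s\<close> define a policy; where the state mass is 0 any
  distribution will do. Its state-action law obeys the same recursion as \<open>\<mu>\<close>, hence equals \<open>\<mu>\<close> up to
  the horizon.
\<close>

lemma mdp_policy_of_relax_feasible:
  fixes M :: "('s::finite, 'o::finite, 'a::finite) pomdp"
  assumes "relax_feasible M T b \<mu> \<delta>"
  shows "\<exists>\<pi>. mdp_objective M T b \<pi> = milp_objective M T \<mu>"
proof -
  note f = relax_feasibleD[OF assms]
  have "\<exists>q. t \<le> T \<longrightarrow> (\<forall>a. mu_sa \<mu> t s a = mu_s \<mu> t s * pmf q a)" for t s
  proof (cases "t \<le> T")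
    case t: True
    show ?thesis
    proof (cases "mu_s \<mu> t s = 0")
      case True
      then have "mu_sa \<mu> t s a = 0" for a
        using f(2)[OF t, of s] f(6)[OF t, of s] by (simp add: sum_nonneg_eq_0_iff)
      then show ?thesis using True by simp
    next
      case False
      have "\<exists>q. pmf q = (\<lambda>a. mu_sa \<mu> t s a / mu_s \<mu> t s)"
        by (rule ex_pmf_of_weights)
          (use False f(5)[of t] t in
            \<open>simp_all add: f(6)[OF t] flip: sum_divide_distrib f(2)[OF t]\<close>)
      then obtain q where "pmf q = (\<lambda>a. mu_sa \<mu> t s a / mu_s \<mu> t s)" ..
      then show ?thesis using False by (intro exI[of _ q]) simp
    qed
  qed simp
  then obtain \<pi> where \<pi>: "\<And>t s a. t \<le> T \<Longrightarrow> mu_sa \<mu> t s a = mu_s \<mu> t s * pmf (\<pi> t s) a"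
    by metis
  have state: "pmf (mdp_state M b \<pi> t) s = mu_s \<mu> t s" if "t \<le> T" for t s
    using that
  proof (induction t arbitrary: s)
    case 0
    then show ?case by (simp add: mdp_state_def f(1))
  next
    case (Suc t)
    have "pmf (mdp_state M b \<pi> (Suc t)) s =
        (\<Sum>s'\<in>UNIV. \<Sum>a'\<in>UNIV. pmf (mdp_occ M b \<pi> t) (s', a') * pmf (step M s' a') s)"
      by (simp add: mdp_state_def pmf_bind_finite sum_UNIV_prod)
    then show ?case
      using Suc by (simp add: f(4) pmf_mdp_occ \<pi> mult.commute)
  qed
  have "mdp_objective M T b \<pi> = milp_objective M T \<mu>"
    by (simp add: mdp_objective_eq milp_objective_def pmf_mdp_occ state \<pi>)
  then show ?thesis by (intro exI)
qed

text \<open>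
  The MDP policy ignores observations, so an observation drawn afterwards, independently of the
  action given the state, completes its state-action law to a law of triples.
\<close>

lemma relax_feasible_of_mdp_policy:
  fixes M :: "('s::finite, 'o::finite, 'a::finite) pomdp"
  shows "\<exists>\<mu> \<delta>. relax_feasible M T b \<mu> \<delta> \<and> milp_objective M T \<mu> = mdp_objective M T b \<pi>"
proof -
  define L where "L t = mdp_occ M b \<pi> t \<bind> (\<lambda>x. map_pmf (\<lambda>ob. (fst x, ob, snd x)) (obs M (fst x)))" for t
  have L: "pmf (L t) (s, ob, a) = pmf (mdp_occ M b \<pi> t) (s, a) * pmf (obs M s) ob" for t s ob a
    unfolding L_def
    using pmf_bind_map[of "\<lambda>x ob. (fst x, ob, snd x)" _ "\<lambda>x. obs M (fst x)" "(s, a)"]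
    by (auto simp: prod_eq_iff)
  have "relax_feasible M T b (law_vars (mdp_state M b \<pi>) L) (\<lambda>t ob. map_pmf (snd \<circ> snd) (L t))"
  proof (rule relax_feasible_law_vars)
    show "mdp_state M b \<pi> (Suc t) = L t \<bind> (\<lambda>(s, ob, a). step M s a)" for t
      by (simp add: mdp_state_def L_def bind_assoc_pmf bind_map_pmf case_prod_beta')
    show "(\<Sum>a\<in>UNIV. pmf (L t) (s, ob, a)) = pmf (mdp_state M b \<pi> t) s * pmf (obs M s) ob" for t s ob
      by (simp add: L pmf_mdp_occ sum_pmf_UNIV flip: sum_distrib_left sum_distrib_right)
  qed (simp add: mdp_state_def)
  moreover have "milp_objective M T (law_vars (mdp_state M b \<pi>) L) = mdp_objective M T b \<pi>"
    by (simp add: milp_objective_def law_vars_def L mdp_objective_eq sum_pmf_UNIV flip: sum_distrib_left)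
  ultimately show ?thesis by blast
qed

section \<open>History-dependent policies satisfy the inequalities (V)\<close>

text \<open>
  Take \<open>\<mu>\<close> and \<open>\<nu>\<close> to be the laws of \<open>(S\<^sub>t, O\<^sub>t, A\<^sub>t)\<close> and \<open>(S\<^sub>t\<^sub>-\<^sub>1, A\<^sub>t\<^sub>-\<^sub>1, S\<^sub>t, O\<^sub>t, A\<^sub>t)\<close>. The
  action \<open>A\<^sub>t\<close> depends on the past and on \<open>O\<^sub>t\<close>, but not on \<open>S\<^sub>t\<close> otherwise; therefore \<open>\<nu>\<close> factors as
  \<open>p(o|s) p(s|s',a') g(s',a',o,a)\<close>, where \<open>g\<close> collects the average over histories. The third
  family in (V) asks precisely for this dependence on \<open>s\<close>.
\<close>

lemma Rc_feasible_of_policy: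
  fixes M :: "('s::finite, 'o::finite, 'a::finite) pomdp" and \<delta> :: "('o, 'a) hist_policy"
  shows "\<exists>\<mu> d \<nu>. relax_feasible M T b \<mu> d \<and> valid_ineqs M T \<mu> \<nu> \<and>
    milp_objective M T \<mu> = measure_pmf.expectation (trajectory M b \<delta> T) (total_reward M T)"
proof -
  interpret sequential_law "trajectory M b \<delta>" "obs_act M (\<delta> 0 []) b"
    "\<lambda>t \<omega>. obs_act M (\<delta> (Suc t) (map snd \<omega>)) (case last \<omega> of (s', ob', a') \<Rightarrow> step M s' a')"
    by (rule trajectory_sequential)
  define E :: "nat \<Rightarrow> _ \<Rightarrow> real" where "E t = measure_pmf.expectation (trajectory M b \<delta> t)" for t
  define L where "L t = map_pmf last (trajectory M b \<delta> t)" for t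
  define nxt where "nxt = (\<lambda>(s', ob' :: 'o, a'). step M s' a')"
  define \<sigma> where "\<sigma> t = (case t of 0 \<Rightarrow> b | Suc t \<Rightarrow> L t \<bind> nxt)" for t
  define g where "g t s' a' ob a = E t (\<lambda>\<omega>. indicat_real {(s', a')} (fst (last \<omega>), snd (snd (last \<omega>))) *
    pmf (\<delta> (Suc t) (map snd \<omega>) ob) a)" for t s' a' ob a
  define \<nu> where "\<nu> t s' a' s ob a =
    pmf (obs M s) ob * pmf (step M s' a') s * g (t - 1) s' a' ob a"
    for t s' a' s ob a
  have integrable: "integrable (measure_pmf (trajectory M b \<delta> t)) h" for t and h :: "_ \<Rightarrow> real"
    by (rule integrable_measure_pmf_finite[OF finite_law])
  have E_sum: "E t (\<lambda>\<omega>. \<Sum>i\<in>UNIV. h i \<omega>) = (\<Sum>i\<in>UNIV. E t (h i))" for t and h :: "'i::finite \<Rightarrow> _"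
    unfolding E_def by (rule Bochner_Integration.integral_sum) (rule integrable)
  have L_Suc: "pmf (L (Suc t)) (s, ob, a) =
      pmf (obs M s) ob * E t (\<lambda>\<omega>. pmf (nxt (last \<omega>)) s * pmf (\<delta> (Suc t) (map snd \<omega>) ob) a)" for t s ob a
    unfolding L_def map_last_law_Suc E_def nxt_def
    by (simp add: pmf_bind pmf_obs_act mult.assoc mult.left_commute flip: integral_mult_right_zero)
  have \<sigma>_Suc: "pmf (\<sigma> (Suc t)) s = E t (\<lambda>\<omega>. pmf (nxt (last \<omega>)) s)" for t s
    by (simp add: \<sigma>_def L_def E_def pmf_bind)
  have obs: "(\<Sum>a\<in>UNIV. pmf (L t) (s, ob, a)) = pmf (\<sigma> t) s * pmf (obs M s) ob" for t s ob
  proof (cases t)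
    case 0
    then show ?thesis
      by (simp add: L_def map_last_law_0 \<sigma>_def pmf_obs_act sum_pmf_UNIV flip: sum_distrib_left
        del: trajectory.simps)
  next
    case (Suc t')
    then show ?thesis
      by (simp add: L_Suc \<sigma>_Suc sum_pmf_UNIV flip: sum_distrib_left E_sum)
  qed
  have feas: "relax_feasible M T b (law_vars \<sigma> L) (\<lambda>t ob. map_pmf (snd \<circ> snd) (L t))"
  proof (rule relax_feasible_law_vars)
    show "\<sigma> 0 = b" by (simp add: \<sigma>_def)
    show "\<sigma> (Suc t) = L t \<bind> (\<lambda>(s, ob, a). step M s a)" for t
      by (simp add: \<sigma>_def nxt_def)
  qed (rule obs)
  have g_nonneg: "g t s' a' ob a \<ge> 0" for t s' a' ob a
    by (simp add: g_def E_def)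
  have g_sum: "(\<Sum>a\<in>UNIV. g t s' a' ob a) = (\<Sum>ob\<in>UNIV. pmf (L t) (s', ob, a'))" for t s' a' ob
  proof -
    have "(\<Sum>a\<in>UNIV. g t s' a' ob a) =
        E t (\<lambda>\<omega>. indicat_real {(s', a')} (fst (last \<omega>), snd (snd (last \<omega>))))"
      by (simp add: g_def sum_pmf_UNIV flip: E_sum sum_distrib_left)
    also have "\<dots> = measure_pmf.expectation (L t)
        (\<lambda>x. indicat_real {(s', a')} (fst x, snd (snd x)))"
      by (simp add: E_def L_def)
    also have "\<dots> = (\<Sum>x\<in>UNIV. indicat_real {(s', a')} (fst x, snd (snd x)) * pmf (L t) x)"
      by (rule integral_measure_pmf_real) auto
    also have "\<dots> = (\<Sum>s\<in>UNIV. \<Sum>ob\<in>UNIV. \<Sum>a\<in>UNIV.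
        if a = a' then if s = s' then pmf (L t) (s, ob, a) else 0 else 0)"
      unfolding sum_UNIV_prod by (intro sum.cong refl) (auto simp: indicator_def)
    also have "\<dots> = (\<Sum>ob\<in>UNIV. pmf (L t) (s', ob, a'))"
      by (simp, subst sum.swap, simp)
    finally show ?thesis .
  qed
  have "valid_ineqs M T (law_vars \<sigma> L) \<nu>"
    unfolding valid_ineqs_def
  proof (intro ballI conjI allI)
    fix t assume "t \<in> {1..T}"
    then obtain t' where t: "t = Suc t'" by (cases t) auto
    show "\<nu> t s' a' s ob a \<ge> 0" for s' a' s ob a
      by (simp add: \<nu>_def g_nonneg)
    show "(\<Sum>a\<in>UNIV. \<nu> t s' a' s ob a) =
        pmf (obs M s) ob * pmf (step M s' a') s * mu_sa (law_vars \<sigma> L) (t - 1) s' a'" for s' a' s ob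
      by (simp add: \<nu>_def t law_vars_def g_sum flip: sum_distrib_left)
    show "\<nu> t s' a' s ob a = state_posterior M s s' a' ob * (\<Sum>s''\<in>UNIV. \<nu> t s' a' s'' ob a)"
      for s' a' s ob a
    proof -
      let ?w = "\<lambda>s. pmf (obs M s) ob * pmf (step M s' a') s"
      (* a vanishing denominator of the posterior forces all its numerators to vanish *)
      have "?w s = 0" if "(\<Sum>s\<in>UNIV. ?w s) = 0"
        using that by (subst (asm) sum_nonneg_eq_0_iff) auto
      moreover have "(\<Sum>s''\<in>UNIV. \<nu> t s' a' s'' ob a) = (\<Sum>s\<in>UNIV. ?w s) * g t' s' a' ob a"
        by (simp add: \<nu>_def t sum_distrib_right)
      ultimately show ?thesis
        unfolding state_posterior_def by (cases "(\<Sum>s\<in>UNIV. ?w s) = 0") (simp_all add: \<nu>_def t)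
    qed
    show "(\<Sum>s'\<in>UNIV. \<Sum>a'\<in>UNIV. \<nu> t s' a' s ob a) = mu_soa (law_vars \<sigma> L) t s ob a" for s ob a
    proof -
      (* splitting by the previous state and action turns the kernel into a constant factor *)
      have split: "pmf (nxt x) s * c = (\<Sum>s'\<in>UNIV. \<Sum>a'\<in>UNIV.
          pmf (step M s' a') s * (indicat_real {(s', a')} (fst x, snd (snd x)) * c))" for x c
      proof -
        have "(\<Sum>s'\<in>UNIV. \<Sum>a'\<in>UNIV. pmf (step M s' a') s * (indicat_real {(s', a')} (fst x, snd (snd x)) * c)) =
          (\<Sum>s'\<in>UNIV. \<Sum>a'\<in>UNIV. if s' = fst x then if a' = snd (snd x) then pmf (step M s' a') s * c else 0 else 0)"
          by (intro sum.cong refl) (auto simp: indicator_def)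
        also have "\<dots> = pmf (nxt x) s * c"
          by (subst sum.swap) (simp add: nxt_def case_prod_beta)
        finally show ?thesis ..
      qed
      have "E t' (\<lambda>\<omega>. pmf (nxt (last \<omega>)) s * pmf (\<delta> (Suc t') (map snd \<omega>) ob) a) =
          (\<Sum>s'\<in>UNIV. \<Sum>a'\<in>UNIV. pmf (step M s' a') s * g t' s' a' ob a)"
        unfolding split E_sum g_def by (simp add: E_def)
      then show ?thesis
        by (simp add: law_vars_def t L_Suc \<nu>_def sum_distrib_left mult.assoc)
    qed
  qed
  moreover have "milp_objective M T (law_vars \<sigma> L) =
      measure_pmf.expectation (trajectory M b \<delta> T) (total_reward M T)"
    unfolding milp_objective_law_vars total_reward_def L_def
    by (rule expectation_sum_law[symmetric])
  ultimately show ?thesis using feas by blast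
qed

section \<open>Comparison of the optimal values\<close>

theorem theorem4:
  fixes M :: "('s::finite, 'o::finite, 'a::finite) pomdp"
    and b :: "'s pmf"
    and T :: nat
  shows "(\<forall>\<mu> \<delta>. relax_feasible M T b \<mu> \<delta> \<longrightarrow>
            (\<exists>\<pi>. mdp_objective M T b \<pi> = milp_objective M T \<mu>))
       \<and> (\<forall>\<pi>. \<exists>\<mu> \<delta>. relax_feasible M T b \<mu> \<delta> \<and>
            milp_objective M T \<mu> = mdp_objective M T b \<pi>)
       \<and> z_R M T b = z_mdp M T b
       \<and> w_ml M T b \<le> w_hist M T b
       \<and> w_hist M T b \<le> z_Rc M T b
       \<and> z_Rc M T b \<le> z_R M T b"
proof (intro conjI)
  show to_mdp: "\<forall>\<mu> \<delta>. relax_feasible M T b \<mu> \<delta> \<longrightarrow>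
      (\<exists>\<pi>. mdp_objective M T b \<pi> = milp_objective M T \<mu>)"
    using mdp_policy_of_relax_feasible by blast
  show from_mdp: "\<forall>\<pi>. \<exists>\<mu> \<delta>. relax_feasible M T b \<mu> \<delta> \<and>
      milp_objective M T \<mu> = mdp_objective M T b \<pi>"
    using relax_feasible_of_mdp_policy by blast
  have "(\<exists>\<mu> \<delta>. relax_feasible M T b \<mu> \<delta> \<and> v = milp_objective M T \<mu>) \<longleftrightarrow>
      (\<exists>\<pi>. v = mdp_objective M T b \<pi>)" for v
    using to_mdp from_mdp by metis
  then show "z_R M T b = z_mdp M T b"
    by (simp add: z_R_def z_mdp_def)
  show "w_ml M T b \<le> w_hist M T b"
    unfolding w_ml_def w_hist_def
    by (rule Greatest_mono_compact[OF compact_w_ml_values _ compact_w_hist_values]) blast+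
  have R: "compact {v. \<exists>\<mu> \<delta>. relax_feasible M T b \<mu> \<delta> \<and> v = milp_objective M T \<mu>}"
    using compact_relaxation_values[of M T b False] by simp
  have Rc: "compact {v. \<exists>\<mu> \<delta> \<nu>. relax_feasible M T b \<mu> \<delta> \<and> valid_ineqs M T \<mu> \<nu> \<and>
      v = milp_objective M T \<mu>}"
    using compact_relaxation_values[of M T b True] by simp
  have hist: "\<exists>\<mu> d \<nu>. relax_feasible M T b \<mu> d \<and> valid_ineqs M T \<mu> \<nu> \<and>
      expected_reward M T b a \<delta> = milp_objective M T \<mu>" for a and \<delta> :: "('o, 'a) hist_policy"
    unfolding expected_reward_def using Rc_feasible_of_policy by metis
  show "w_hist M T b \<le> z_Rc M T b"
    unfolding w_hist_def z_Rc_def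
    by (rule Greatest_mono_compact[OF compact_w_hist_values _ Rc]) (use hist in blast)+
  show "z_Rc M T b \<le> z_R M T b"
    unfolding z_Rc_def z_R_def
    by (rule Greatest_mono_compact[OF Rc _ R]) (use hist in blast)+
qed

end
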